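(* The interacting particle system $\bar\xi_t\in\{0,1\}^{\mathcal{H}}$, $t\ge0$, with the following transitions is well defined, from any initial configuration $\bar\xi_0\in\{0,1\}^{\mathcal{H}}$: (i) each occupied site $x=(x_1,x_2)\in\mathcal{H}$ tries to give birth to each of its nearest neighbors in $\mathcal{H}$ at Poisson rate $\sqrt{x_2}$ if $x_2>0$, and at Poisson rate $1$ if $x_2=0$; (ii) when $x$ attempts to give birth to a nearest neighbor $y$ that is already occupied, the birth is suppressed. Here "well defined" means that the graphical construction of $\bar\xi_t$ given in the context almost surely determines $\bar\xi_t(x)$ for all $x\in\mathcal{H}$ and $t\ge 0$, in the sense that almost surely, for all $x\in\mathcal{H}$ and $t\ge 0$, there are only finitely many $x'\in\mathcal{H}$ with $(x',0)\to(x,t)$.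
   Context: $\mathcal{H}=\{(x_1,x_2)\in\mathbb{Z}^2: x_2\ge 0\}$ with nearest-neighbor adjacency; in a configuration $\xi\in\{0,1\}^{\mathcal H}$ the value $1$ means occupied and $0$ means vacant. Graphical construction: for all ordered pairs of nearest neighbors $x=(x_1,x_2)$, $y$ in $\mathcal{H}$ let $N^{x\to y}_t$, $t\ge0$, be independent Poisson processes, with $N^{x\to y}$ of intensity $\sqrt{x_2}\vee1$. In the space-time set $\mathcal{H}\times[0,\infty)$, draw an oriented arrow from $(x,t)$ to $(y,t)$ at each jump time $t$ of $N^{x\to y}$. For $t_1<t_2$ write $(x,t_1)\to(x',t_2)$ if there is a finite path from $(x,t_1)$ to $(x',t_2)$ that goes vertically upward in time and follows arrows in their direction; also $(x,t)\to(x,t)$ trivially. Given $\bar\xi_0\in\{0,1\}^{\mathcal{H}}$, define $\bar\xi_t(x)=1$ if and only if there is $x'\in\mathcal{H}$ with $\bar\xi_0(x')=1$ and $(x',0)\to(x,t)$. *)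

theory Defs
  imports "HOL-Probability.Probability"
begin

type_synonym site = "int \<times> int"

definition half_plane :: "site set" where
  "half_plane = {x. snd x \<ge> 0}"

text \<open>Ordered pairs of nearest neighbours of the half-plane.\<close>

definition edges :: "(site \<times> site) set" where
  "edges = {(x, y). x \<in> half_plane \<and> y \<in> half_plane \<and>
                    \<bar>fst x - fst y\<bar> + \<bar>snd x - snd y\<bar> = 1}"

definition birth_rate :: "site \<Rightarrow> real" where
  "birth_rate x = max (sqrt (real_of_int (snd x))) 1"

text \<open>
  A Poisson process is a counting process started from 0, with independent Poisson increments and
  almost surely nondecreasing right-continuous sample paths. Only times \<open>t \<ge> 0\<close> matter.
  The truncated subtraction of increments is harmless, because the paths are almost surely
  nondecreasing.
\<close>

definition poisson_process :: "'a measure \<Rightarrow> real \<Rightarrow> (real \<Rightarrow> 'a \<Rightarrow> nat) \<Rightarrow> bool" where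
  "poisson_process M r N \<longleftrightarrow>
     (\<forall>t\<ge>0. N t \<in> measurable M (count_space UNIV)) \<and>
     (AE \<omega> in M. N 0 \<omega> = 0 \<and> mono_on {0..} (\<lambda>t. N t \<omega>) \<and>
        (\<forall>t\<ge>0. continuous (at_right t) (\<lambda>s. N s \<omega>))) \<and>
     (\<forall>n::nat. \<forall>ts::nat \<Rightarrow> real. 0 \<le> ts 0 \<longrightarrow> mono_on {..n} ts \<longrightarrow>
        prob_space.indep_vars M (\<lambda>_. count_space UNIV)
          (\<lambda>i \<omega>. N (ts (Suc i)) \<omega> - N (ts i) \<omega>) {..<n}) \<and>
     (\<forall>s t. 0 \<le> s \<longrightarrow> s < t \<longrightarrow>
        distr M (count_space UNIV) (\<lambda>\<omega>. N t \<omega> - N s \<omega>) =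
          measure_pmf (poisson_pmf (r * (t - s))))"

text \<open>
  A graphical representation: independent Poisson processes attached to the ordered pairs of
  nearest neighbours. Independence is that of the whole processes, as random elements of the
  product space over \<open>[0, \<infinity>)\<close>.
\<close>

definition graphical_representation ::
    "'a measure \<Rightarrow> (site \<times> site \<Rightarrow> real \<Rightarrow> 'a \<Rightarrow> nat) \<Rightarrow> bool" where
  "graphical_representation M N \<longleftrightarrow>
     prob_space M \<and>
     (\<forall>(x, y)\<in>edges. poisson_process M (birth_rate x) (N (x, y))) \<and>
     prob_space.indep_vars M (\<lambda>_. PiM {0..} (\<lambda>_. count_space UNIV))
       (\<lambda>e \<omega>. \<lambda>t\<in>{0..}. N e t \<omega>) edges"

definition jump_time :: "(real \<Rightarrow> nat) \<Rightarrow> real \<Rightarrow> bool" where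
  "jump_time f t \<longleftrightarrow> t > 0 \<and> (\<forall>s\<in>{0..<t}. f s < f t)"

text \<open>\<open>arrow N \<omega> x y t\<close>: there is an arrow from \<open>(x, t)\<close> to \<open>(y, t)\<close>.\<close>

definition arrow ::
    "(site \<times> site \<Rightarrow> real \<Rightarrow> 'a \<Rightarrow> nat) \<Rightarrow> 'a \<Rightarrow> site \<Rightarrow> site \<Rightarrow> real \<Rightarrow> bool" where
  "arrow N \<omega> x y t \<longleftrightarrow> (x, y) \<in> edges \<and> jump_time (\<lambda>s. N (x, y) s \<omega>) t"

inductive oriented_path ::
    "(site \<Rightarrow> site \<Rightarrow> real \<Rightarrow> bool) \<Rightarrow> site \<times> real \<Rightarrow> site \<times> real \<Rightarrow> bool"
  for A where
  start: "oriented_path A p p"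
| up: "oriented_path A p (x, s) \<Longrightarrow> s \<le> t \<Longrightarrow> oriented_path A p (x, t)"
| follow: "oriented_path A p (x, t) \<Longrightarrow> A x y t \<Longrightarrow> oriented_path A p (y, t)"

definition leads_to ::
    "(site \<Rightarrow> site \<Rightarrow> real \<Rightarrow> bool) \<Rightarrow> site \<times> real \<Rightarrow> site \<times> real \<Rightarrow> bool" where
  "leads_to A p q \<longleftrightarrow> p = q \<or> snd p < snd q \<and> oriented_path A p q"

definition ancestors :: "(site \<Rightarrow> site \<Rightarrow> real \<Rightarrow> bool) \<Rightarrow> real \<Rightarrow> site \<Rightarrow> site set" where
  "ancestors A t x = {x' \<in> half_plane. leads_to A (x', 0) (x, t)}"

text \<open>
  Configurations are predicates on sites, \<open>True\<close> meaning occupied; values outside the half-plane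
  are ignored. \<open>xi_bar A \<xi> t\<close> is the configuration at time \<open>t\<close> started from \<open>\<xi>\<close>.
\<close>

definition xi_bar ::
    "(site \<Rightarrow> site \<Rightarrow> real \<Rightarrow> bool) \<Rightarrow> (site \<Rightarrow> bool) \<Rightarrow> real \<Rightarrow> site \<Rightarrow> bool" where
  "xi_bar A \<xi> t x \<longleftrightarrow> (\<exists>x'\<in>half_plane. \<xi> x' \<and> leads_to A (x', 0) (x, t))"

end

theory Submission
  imports Defs "HOL-Real_Asymp.Real_Asymp"
begin

text \<open>
  Time can be spent waiting at a site, so every ancestor of \<open>(x, t)\<close> is joined to it by a path whose
  sites are pairwise distinct; the arrows of such a path belong to distinct, hence independent,
  Poisson processes. Cut \<open>[0, T]\<close> into \<open>k\<close> intervals. There are at most \<open>4 ^ k\<close> site paths with \<open>k\<close>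
  steps ending at \<open>x\<close> and at most \<open>4 ^ k\<close> nondecreasing assignments of the steps to intervals; each
  step costs a factor of at most \<open>sqrt (h + k) * T / k\<close>, where \<open>h\<close> is the height of \<open>x\<close>. The union
  bound \<open>(16 * T * sqrt (h + k) / k) ^ k\<close> tends to \<open>0\<close>, so almost surely, for some \<open>k\<close>, no such path
  has \<open>k\<close> or more steps.
\<close>

section \<open>Self-avoiding paths\<close>

text \<open>Induction along the path. When an arrow returns to a visited site, the loop is erased
  and replaced by waiting at that site. The bound \<open>s i \<le> t\<close> is carried along so
  that a newly appended arrow at time \<open>t\<close> keeps the times nondecreasing.\<close>

lemma oriented_path_imp_simple:
  assumes "oriented_path A (x', 0) (x, t)"
  shows "\<exists>n y s. y 0 = x' \<and> y n = x \<and> inj_on y {..n} \<and>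
           (\<forall>i<n. A (y i) (y (Suc i)) (s i) \<and> s i \<le> t) \<and>
           (\<forall>i j. i \<le> j \<longrightarrow> j < n \<longrightarrow> s i \<le> (s j :: real))"
  using assms
proof (induction "(x', 0::real)" "(x, t)" arbitrary: x t rule: oriented_path.induct)
  case start
  show ?case
    by (rule exI[of _ 0], rule exI[of _ "\<lambda>_. x'"]) auto
next
  case (up x s t)
  then obtain n y u where "y 0 = x'" "y n = x" "inj_on y {..n}"
    "\<And>i. i < n \<Longrightarrow> A (y i) (y (Suc i)) (u i) \<and> u i \<le> s"
    "\<And>i j. i \<le> j \<Longrightarrow> j < n \<Longrightarrow> u i \<le> (u j :: real)"
    by blast
  with up.hyps(3) show ?case
    by (intro exI[of _ n] exI[of _ y] exI[of _ u]) (auto intro: order_trans)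
next
  case (follow x t y')
  then obtain n y s where y: "y 0 = x'" "y n = x" "inj_on y {..n}"
    "\<And>i. i < n \<Longrightarrow> A (y i) (y (Suc i)) (s i) \<and> s i \<le> t"
    "\<And>i j. i \<le> j \<Longrightarrow> j < n \<Longrightarrow> s i \<le> (s j :: real)"
    by blast
  show ?case
  proof (cases "y' \<in> y ` {..n}")
    case True
    then obtain m where "m \<le> n" "y' = y m" by auto
    \<comment> \<open>Keep only the first \<open>m\<close> arrows: their times are already at most
      \<open>t\<close>, and the remaining time is spent at \<open>y m\<close>.\<close>
    with y show ?thesis
      by (intro exI[of _ m] exI[of _ y] exI[of _ s]) (auto intro: inj_on_subset)
  next
    case False
    have "inj_on (y(Suc n := y')) {..Suc n}"
      using y(3) False by (auto simp: inj_on_def le_Suc_eq)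
    with y follow.hyps(3) show ?thesis
      by (intro exI[of _ "Suc n"] exI[of _ "y(Suc n := y')"] exI[of _ "s(n := t)"])
         (auto simp: less_Suc_eq)
  qed
qed

section \<open>Counting site paths and assignments to time intervals\<close>

text \<open>Paths grow backwards in time from the fixed end \<open>x\<close>: the head is the
  earliest site, and the edges point along the list towards \<open>x\<close>.\<close>

primrec paths_to :: "nat \<Rightarrow> site \<Rightarrow> site list set" where
  "paths_to 0 x = {[x]}"
| "paths_to (Suc k) x = {y # p | y p. p \<in> paths_to k x \<and> (y, hd p) \<in> edges}"

lemma length_paths_to: "p \<in> paths_to k x \<Longrightarrow> length p = Suc k"
  by (induction k arbitrary: p) auto

lemma paths_to_edge:
  "p \<in> paths_to k x \<Longrightarrow> i < k \<Longrightarrow> (p ! i, p ! Suc i) \<in> edges"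
proof (induction k arbitrary: p i)
  case (Suc k)
  then obtain y q where q: "p = y # q" "q \<in> paths_to k x" "(y, hd q) \<in> edges" by auto
  then have "q \<noteq> []" using length_paths_to by fastforce
  with q Suc show ?case by (cases i) (auto simp: hd_conv_nth)
qed simp

text \<open>Each edge changes the height by at most one. This is what controls the unbounded birth
  rates along a path of \<open>k\<close> steps.\<close>

lemma paths_to_height:
  "p \<in> paths_to k x \<Longrightarrow> y \<in> set p \<Longrightarrow> snd y \<le> snd x + int k"
proof (induction k arbitrary: p y)
  case (Suc k)
  then obtain z q where q: "p = z # q" "q \<in> paths_to k x" "(z, hd q) \<in> edges" by auto
  then have "q \<noteq> []" using length_paths_to by fastforce
  then have "hd q \<in> set q" by simp
  then have "snd (hd q) \<le> snd x + int k" using Suc.IH q by blast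
  moreover have "snd z \<le> snd (hd q) + 1" using q(3) by (auto simp: edges_def)
  ultimately show ?case using Suc q by fastforce
qed simp

lemma paths_to_finite_card: "finite (paths_to k x) \<and> card (paths_to k x) \<le> 4 ^ k"
proof (induction k)
  case (Suc k)
  define D :: "(int \<times> int) set" where "D = {(1, 0), (-1, 0), (0, 1), (0, -1)}"
  let ?f = "\<lambda>(d, p). (fst (hd p) + fst d, snd (hd p) + snd d) # p"
  have D: "finite D" "card D = 4" by (auto simp: D_def)
  \<comment> \<open>A prepended site is one of the four translates of the current head; only an
    inclusion holds, since a translate may leave the half-plane.\<close>
  have "paths_to (Suc k) x \<subseteq> ?f ` (D \<times> paths_to k x)"
  proof
    fix p assume "p \<in> paths_to (Suc k) x"
    then obtain y q where q: "p = y # q" "q \<in> paths_to k x" "(y, hd q) \<in> edges" by auto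
    have "(fst y - fst (hd q), snd y - snd (hd q)) \<in> D"
      using q(3) unfolding edges_def D_def by auto
    then show "p \<in> ?f ` (D \<times> paths_to k x)"
      using q by (intro image_eqI[of _ _ "((fst y - fst (hd q), snd y - snd (hd q)), q)"]) auto
  qed
  moreover have "finite (D \<times> paths_to k x)" using D Suc by auto
  ultimately have "finite (paths_to (Suc k) x)"
    and "card (paths_to (Suc k) x) \<le> card (D \<times> paths_to k x)"
    by (auto intro: finite_surj surj_card_le)
  then show ?case using D Suc by (auto simp: card_cartesian_product)
qed simp

text \<open>Cuts a walk down to its last \<open>k\<close> steps. The initial part is dropped because
  the end \<open>y n\<close> is the site that stays fixed.\<close>

lemma walk_in_paths_to:
  assumes "k \<le> n" and "\<And>i. i < n \<Longrightarrow> (y i, y (Suc i)) \<in> edges"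
  shows "map y [n - k..<Suc n] \<in> paths_to k (y n)"
  using assms(1)
proof (induction k)
  case (Suc k)
  have "n - k = Suc (n - Suc k)" using Suc.prems by auto
  then have eq: "[n - Suc k..<Suc n] = (n - Suc k) # [n - k..<Suc n]"
    using Suc.prems by (metis diff_le_self le_imp_less_Suc upt_conv_Cons)
  have "hd (map y [n - k..<Suc n]) = y (Suc (n - Suc k))"
    using \<open>n - k = Suc (n - Suc k)\<close> by (subst hd_map) (auto simp del: upt_Suc)
  then show ?case
    unfolding eq using Suc assms(2)[of "n - Suc k"]
    by (cases "y (n - Suc k)") (auto simp del: upt_Suc)
qed simp

text \<open>Letter \<open>i\<close> of a word will be the index of the time interval containing
  arrow \<open>i\<close>; sortedness reflects that arrow times are nondecreasing along a
  path.\<close>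

definition sorted_words :: "nat \<Rightarrow> nat \<Rightarrow> nat list set" where
  "sorted_words k m = {c. length c = k \<and> sorted c \<and> set c \<subseteq> {..<m}}"

text \<open>Pascal's recursion: a sorted word either avoids the largest letter, or ends in it and
  that last letter can be removed. For \<open>k = m\<close> the bound is
  \<open>4 ^ k\<close>.\<close>

lemma sorted_words_finite_card:
  "finite (sorted_words k m) \<and> card (sorted_words k m) \<le> 2 ^ (k + m)"
proof (induction "k + m" arbitrary: k m)
  case 0
  then have "sorted_words k m = {[]}" by (auto simp: sorted_words_def)
  then show ?case by simp
next
  case (Suc n)
  consider "k = 0" | "m = 0" "k > 0" | k' m' where "k = Suc k'" "m = Suc m'"
    using gr0_conv_Suc not0_implies_Suc by blast
  then show ?case
  proof cases
    case 1
    then have "sorted_words k m = {[]}" by (auto simp: sorted_words_def)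
    then show ?thesis by simp
  next
    case 2
    then have "sorted_words k m = {}" by (auto simp: sorted_words_def)
    then show ?thesis by simp
  next
    case 3
    let ?f = "\<lambda>c. c @ [m']"
    have sub: "sorted_words k m \<subseteq> sorted_words k m' \<union> ?f ` sorted_words k' m"
    proof
      fix c assume c: "c \<in> sorted_words k m"
      then have "c \<noteq> []" using 3 by (auto simp: sorted_words_def)
      then obtain b a where ba: "c = b @ [a]" by (metis rev_exhaust)
      show "c \<in> sorted_words k m' \<union> ?f ` sorted_words k' m"
      proof (cases "a = m'")
        case True
        then show ?thesis using c ba 3 by (auto simp: sorted_words_def sorted_append)
      next
        case False
        \<comment> \<open>The last letter of a sorted word is its largest, so all letters lie below
          \<open>m'\<close>.\<close>
        then have "a < m'" using c ba 3 by (auto simp: sorted_words_def)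
        then show ?thesis using c ba 3 by (fastforce simp: sorted_words_def sorted_append)
      qed
    qed
    have IH1: "finite (sorted_words k m')" "card (sorted_words k m') \<le> 2 ^ (k + m')"
      using Suc.hyps(1)[of k m'] Suc.hyps(2) 3 by auto
    have IH2: "finite (sorted_words k' m)" "card (sorted_words k' m) \<le> 2 ^ (k' + m)"
      using Suc.hyps(1)[of k' m] Suc.hyps(2) 3 by auto
    have "card (sorted_words k m) \<le> card (sorted_words k m' \<union> ?f ` sorted_words k' m)"
      using sub IH1 IH2 by (intro card_mono) auto
    also have "\<dots> \<le> card (sorted_words k m') + card (sorted_words k' m)"
      by (intro order_trans[OF card_Un_le] add_mono card_image_le IH2) auto
    also have "\<dots> \<le> 2 ^ (k + m)" using IH1 IH2 3 by simp
    finally show ?thesis using sub IH1 IH2 by (auto intro: finite_subset)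
  qed
qed

section \<open>The union bound\<close>

text \<open>The increment is Poisson with mean \<open>r * (t - s)\<close>, hence nonzero with
  probability \<open>1 - exp (- (r * (t - s)))\<close>, and
  \<open>1 - exp (- z) \<le> z\<close>.\<close>

lemma poisson_process_increment_prob:
  assumes "prob_space M" "poisson_process M r N" "0 < r" "0 \<le> s" "s < t"
  shows "{\<omega>\<in>space M. N s \<omega> < N t \<omega>} \<in> sets M"
    and "measure M {\<omega>\<in>space M. N s \<omega> < N t \<omega>} \<le> r * (t - s)"
proof -
  have [measurable]: "N s \<in> measurable M (count_space UNIV)" "N t \<in> measurable M (count_space UNIV)"
    using assms unfolding poisson_process_def by simp_all
  have "N s \<in> borel_measurable M" "N t \<in> borel_measurable M"
    by (auto simp: measurable_cong_sets[OF refl sets_borel_eq_count_space])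
  then show "{\<omega>\<in>space M. N s \<omega> < N t \<omega>} \<in> sets M" by measurable
  have d: "distr M (count_space UNIV) (\<lambda>\<omega>. N t \<omega> - N s \<omega>) = measure_pmf (poisson_pmf (r * (t - s)))"
    using assms unfolding poisson_process_def by auto
  have "measure M {\<omega>\<in>space M. N s \<omega> < N t \<omega>}
      = measure (distr M (count_space UNIV) (\<lambda>\<omega>. N t \<omega> - N s \<omega>)) (- {0})"
    \<comment> \<open>With truncated subtraction, the difference is nonzero exactly when
      \<open>N s \<omega> < N t \<omega>\<close>.\<close>
    by (subst measure_distr) (auto intro!: arg_cong[where f = "measure M"])
  also have "\<dots> = 1 - pmf (poisson_pmf (r * (t - s))) 0"
    unfolding d using measure_pmf.prob_compl[of "{0}" "poisson_pmf (r * (t - s))"]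
    by (simp add: Compl_eq_Diff_UNIV measure_pmf_single)
  also have "\<dots> = 1 - exp (- (r * (t - s)))"
    using assms by (simp add: pmf_poisson)
  also have "\<dots> \<le> r * (t - s)" using exp_ge_add_one_self[of "- (r * (t - s))"] by linarith
  finally show "measure M {\<omega>\<in>space M. N s \<omega> < N t \<omega>} \<le> r * (t - s)" .
qed

text \<open>Each event depends on the process of a single edge, and the edges are distinct, so
  independence turns the intersection into a product.\<close>

lemma prob_increments_distinct_edges:
  fixes k :: nat
  assumes gr: "graphical_representation M N"
    and e: "inj_on e {..<k}" "\<And>i. i < k \<Longrightarrow> e i \<in> edges"
    and ab: "\<And>i. i < k \<Longrightarrow> 0 \<le> a i \<and> a i < b i"
    and k: "k > 0"
  shows "measure M (\<Inter>i<k. {\<omega>\<in>space M. N (e i) (a i) \<omega> < N (e i) (b i) \<omega>})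
           \<le> (\<Prod>i<k. birth_rate (fst (e i)) * (b i - a i))"
proof -
  interpret prob_space M using gr unfolding graphical_representation_def by auto
  define X where "X = (\<lambda>e \<omega>. \<lambda>t\<in>{0..}. N e t \<omega>)"
  define P where "P = PiM {0::real..} (\<lambda>_. count_space (UNIV :: nat set))"
  have ind: "indep_vars (\<lambda>_. P) X edges"
    using gr unfolding graphical_representation_def X_def P_def by auto
  define J where "J = e ` {..<k}"
  \<comment> \<open>Independence is indexed by edges, the events by steps; \<open>g\<close> recovers
    the step from its edge.\<close>
  define g where "g = inv_into {..<k} e"
  have g: "g (e i) = i" if "i < k" for i
    using that e(1) by (simp add: g_def inv_into_f_f)
  define B where "B = (\<lambda>d. {f\<in>space P. f (a (g d)) < f (b (g d))})"
  have B: "B d \<in> sets P" if "d \<in> J" for d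
  proof -
    have "g d < k" using that g unfolding J_def by auto
    then have "a (g d) \<in> {0..}" "b (g d) \<in> {0..}" using ab by force+
    then have "(\<lambda>f. f (a (g d))) \<in> borel_measurable P" "(\<lambda>f. f (b (g d))) \<in> borel_measurable P"
      unfolding P_def measurable_cong_sets[OF refl sets_borel_eq_count_space]
      by (auto intro: measurable_component_singleton)
    then show ?thesis unfolding B_def by measurable
  qed
  \<comment> \<open>The restriction to \<open>{0..}\<close> in \<open>X\<close> is invisible here,
    because \<open>a i\<close> and \<open>b i\<close> are nonnegative.\<close>
  have pre: "X (e i) -` B (e i) \<inter> space M = {\<omega>\<in>space M. N (e i) (a i) \<omega> < N (e i) (b i) \<omega>}"
    if "i < k" for i
    using ab[OF that] by (auto simp: B_def g[OF that] X_def P_def space_PiM)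
  have "measure M (\<Inter>i<k. {\<omega>\<in>space M. N (e i) (a i) \<omega> < N (e i) (b i) \<omega>})
      = measure M (\<Inter>d\<in>J. X d -` B d \<inter> space M)"
    unfolding J_def image_image using pre
    by (intro arg_cong[where f = "measure M"] INF_cong) auto
  also have "\<dots> = (\<Prod>d\<in>J. measure M (X d -` B d \<inter> space M))"
    using e k by (intro indep_varsD[OF ind]) (auto simp: J_def intro!: B[unfolded J_def])
  also have "\<dots> = (\<Prod>i<k. measure M {\<omega>\<in>space M. N (e i) (a i) \<omega> < N (e i) (b i) \<omega>})"
    unfolding J_def by (subst prod.reindex[OF e(1)]) (auto intro!: prod.cong simp: pre)
  also have "\<dots> \<le> (\<Prod>i<k. birth_rate (fst (e i)) * (b i - a i))"
  proof (rule prod_mono, intro conjI)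
    fix i assume "i \<in> {..<k}"
    then have i: "i < k" by simp
    have "poisson_process M (birth_rate (fst (e i))) (N (e i))"
      using gr e(2)[OF i] unfolding graphical_representation_def by (auto simp: case_prod_beta)
    then show "measure M {\<omega>\<in>space M. N (e i) (a i) \<omega> < N (e i) (b i) \<omega>}
        \<le> birth_rate (fst (e i)) * (b i - a i)"
      using ab[OF i]
      by (intro poisson_process_increment_prob) (auto simp: prob_space_axioms birth_rate_def)
  qed simp
  finally show ?thesis .
qed

section \<open>Long self-avoiding paths are unlikely\<close>

text \<open>Expressed by increments over a grid of mesh \<open>T / k\<close> instead of actual
  paths: a finite union of measurable events. Arrows sharing an interval need not occur in path
  order, so the event is only necessary for a long path.\<close>

definition long_path_event ::
    "'a measure \<Rightarrow> (site \<times> site \<Rightarrow> real \<Rightarrow> 'a \<Rightarrow> nat) \<Rightarrow> real \<Rightarrow> nat \<Rightarrow> site \<Rightarrow> 'a set" where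
  "long_path_event M N T k x =
     (\<Union>(p, c) \<in> {p \<in> paths_to k x. distinct p} \<times> sorted_words k k. \<Inter>i<k.
        {\<omega>\<in>space M. N (p ! i, p ! Suc i) (real (c ! i) * T / k) \<omega>
                    < N (p ! i, p ! Suc i) (real (Suc (c ! i)) * T / k) \<omega>})"

lemma long_path_event_prob:
  assumes gr: "graphical_representation M N" and T: "0 < T" and k: "0 < k" and x: "x \<in> half_plane"
  shows "long_path_event M N T k x \<in> sets M"
    and "measure M (long_path_event M N T k x)
           \<le> (16 * T * sqrt (real_of_int (snd x) + k) / k) ^ k"
proof -
  interpret prob_space M using gr unfolding graphical_representation_def by auto
  define I where "I = {p \<in> paths_to k x. distinct p} \<times> sorted_words k k"
  define F where "F = (\<lambda>(p, c). \<Inter>i<k.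
        {\<omega>\<in>space M. N (p ! i, p ! Suc i) (real (c ! i) * T / k) \<omega>
                    < N (p ! i, p ! Suc i) (real (Suc (c ! i)) * T / k) \<omega>})"
  \<comment> \<open>Cost of one step: the largest possible birth rate along the path times the
    mesh.\<close>
  define q where "q = sqrt (real_of_int (snd x) + k) * (T / k)"
  have q0: "q \<ge> 0" using T x by (auto simp: q_def half_plane_def)
  have eq: "long_path_event M N T k x = (\<Union>z\<in>I. F z)"
    unfolding long_path_event_def I_def F_def by simp
  have fin: "finite I" unfolding I_def
    using paths_to_finite_card sorted_words_finite_card by auto
  have "card I \<le> card (paths_to k x) * card (sorted_words k k)"
    unfolding I_def card_cartesian_product
    using paths_to_finite_card by (intro mult_right_mono card_mono) auto
  also have "\<dots> \<le> 4 ^ k * 2 ^ (k + k)"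
    using paths_to_finite_card sorted_words_finite_card by (intro mult_mono) auto
  also have "\<dots> = (16::nat) ^ k"
    by (simp add: power_add power_mult_distrib[symmetric])
  finally have cardI: "card I \<le> 16 ^ k" .
  have F: "F z \<in> sets M \<and> measure M (F z) \<le> q ^ k" if "z \<in> I" for z
  proof -
    obtain p c where z: "z = (p, c)" by force
    have p: "p \<in> paths_to k x" "distinct p" using that z by (auto simp: I_def)
    have lenp: "length p = Suc k" using length_paths_to p by auto
    define e where "e = (\<lambda>i. (p ! i, p ! Suc i))"
    define a where "a = (\<lambda>i. real (c ! i) * T / k)"
    define b where "b = (\<lambda>i. real (Suc (c ! i)) * T / k)"
    have Feq: "F z = (\<Inter>i<k. {\<omega>\<in>space M. N (e i) (a i) \<omega> < N (e i) (b i) \<omega>})"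
      by (simp add: F_def z e_def a_def b_def)
    \<comment> \<open>Distinct sites give edges with distinct sources.\<close>
    have inj: "inj_on e {..<k}"
      using p(2) lenp by (auto simp: inj_on_def e_def nth_eq_iff_index_eq)
    have edge: "e i \<in> edges" if "i < k" for i
      using paths_to_edge[OF p(1) that] by (simp add: e_def)
    have ab: "0 \<le> a i \<and> a i < b i" for i
      using T k by (auto simp: a_def b_def field_simps)
    have len: "b i - a i = T / k" for i
      by (simp add: a_def b_def distrib_right add_divide_distrib)
    have "{\<omega>\<in>space M. N (e i) (a i) \<omega> < N (e i) (b i) \<omega>} \<in> sets M" if "i < k" for i
    proof -
      have "poisson_process M (birth_rate (fst (e i))) (N (e i))"
        using gr edge[OF that] unfolding graphical_representation_def by (auto simp: case_prod_beta)
      then show ?thesis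
        using ab[of i]
        by (intro poisson_process_increment_prob) (auto simp: prob_space_axioms birth_rate_def)
    qed
    then have meas: "F z \<in> sets M"
      unfolding Feq using k by (intro sets.finite_INT) auto
    have "measure M (F z) \<le> (\<Prod>i<k. birth_rate (fst (e i)) * (b i - a i))"
      unfolding Feq using prob_increments_distinct_edges[OF gr inj edge] ab k by blast
    also have "\<dots> \<le> (\<Prod>i<k. q)"
    proof (rule prod_mono, intro conjI)
      fix i assume "i \<in> {..<k}"
      then have "snd (p ! i) \<le> snd x + int k"
        using paths_to_height[OF p(1), of "p ! i"] lenp by auto
      then have "real_of_int (snd (p ! i)) \<le> real_of_int (snd x) + k" by linarith
      \<comment> \<open>This absorbs the maximum with \<open>1\<close> in
        \<open>birth_rate\<close>.\<close>
      moreover have "1 \<le> real_of_int (snd x) + k" using k x by (auto simp: half_plane_def)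
      ultimately have "birth_rate (fst (e i)) \<le> sqrt (real_of_int (snd x) + k)"
        by (auto simp: birth_rate_def e_def)
      then show "birth_rate (fst (e i)) * (b i - a i) \<le> q"
        unfolding len q_def using T by (intro mult_right_mono) auto
      show "0 \<le> birth_rate (fst (e i)) * (b i - a i)"
        unfolding len using T by (auto simp: birth_rate_def)
    qed
    finally show ?thesis using meas by simp
  qed
  show "long_path_event M N T k x \<in> sets M"
    unfolding eq using F fin by auto
  have "measure M (long_path_event M N T k x) \<le> (\<Sum>z\<in>I. measure M (F z))"
    unfolding eq using F fin by (intro finite_measure_subadditive_finite) auto
  also have "\<dots> \<le> of_nat (card I) * q ^ k"
    using F by (intro sum_bounded_above) auto
  also have "\<dots> \<le> 16 ^ k * q ^ k"
    using of_nat_mono[OF cardI, where 'a = real] q0 by (intro mult_right_mono) simp_all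
  also have "\<dots> = (16 * T * sqrt (real_of_int (snd x) + k) / k) ^ k"
    by (simp add: q_def power_mult_distrib[symmetric] mult_ac)
  finally show "measure M (long_path_event M N T k x)
           \<le> (16 * T * sqrt (real_of_int (snd x) + k) / k) ^ k" .
qed

text \<open>The base is of order at most \<open>1 / sqrt k\<close>, hence eventually below
  \<open>1/2\<close>, and a geometric sequence dominates.\<close>

lemma long_path_bound_tendsto_0:
  fixes C h :: real
  assumes "0 \<le> C" "0 \<le> h"
  shows "(\<lambda>k. (C * sqrt (h + real k) / real k) ^ k) \<longlonglongrightarrow> 0"
proof (rule tendsto_sandwich[of "\<lambda>_. 0" _ _ "\<lambda>k. (1/2) ^ k"])
  have "(\<lambda>k. C * (sqrt (h + real k) / real k)) \<longlonglongrightarrow> C * 0"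
    by (intro tendsto_mult tendsto_const) real_asymp
  then have "eventually (\<lambda>k. C * sqrt (h + real k) / real k < 1/2) sequentially"
    by (intro order_tendstoD(2)[where y = 0]) auto
  then show "eventually (\<lambda>k. (C * sqrt (h + real k) / real k) ^ k \<le> (1/2) ^ k) sequentially"
    by eventually_elim (use assms in \<open>auto intro!: power_mono\<close>)
  show "eventually (\<lambda>k. 0 \<le> (C * sqrt (h + real k) / real k) ^ k) sequentially"
    using assms by (intro always_eventually allI zero_le_power) auto
qed (auto intro!: LIMSEQ_realpow_zero)

text \<open>The intersection of the events over all \<open>k > 0\<close> has probability below each
  of the bounds, which tend to \<open>0\<close>.\<close>

lemma AE_not_long_path_event:
  assumes gr: "graphical_representation M N" and T: "0 < T" and x: "x \<in> half_plane"
  shows "AE \<omega> in M. \<exists>k>0. \<omega> \<notin> long_path_event M N T k x"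
proof -
  interpret prob_space M using gr unfolding graphical_representation_def by auto
  define Z where "Z = (\<Inter>k. long_path_event M N T (Suc k) x)"
  have Z: "Z \<in> sets M"
    unfolding Z_def using long_path_event_prob(1)[OF gr T _ x] by (intro sets.countable_INT) auto
  let ?b = "\<lambda>k::nat. (16 * T * sqrt (real_of_int (snd x) + k) / k) ^ k"
  have "?b \<longlonglongrightarrow> 0"
    using T x by (intro long_path_bound_tendsto_0) (auto simp: half_plane_def)
  then have lim: "(\<lambda>k. ?b (Suc k)) \<longlonglongrightarrow> 0" by (rule LIMSEQ_Suc)
  have "measure M Z \<le> ?b (Suc k)" for k
  proof -
    have "measure M Z \<le> measure M (long_path_event M N T (Suc k) x)"
      using long_path_event_prob(1)[OF gr T _ x] by (intro finite_measure_mono) (auto simp: Z_def)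
    also have "\<dots> \<le> ?b (Suc k)" by (rule long_path_event_prob(2)[OF gr T _ x]) simp
    finally show ?thesis .
  qed
  then have "measure M Z \<le> 0" using lim by (intro LIMSEQ_le_const) auto
  then have "measure M Z = 0" using measure_nonneg[of M Z] by linarith
  then have "AE \<omega> in M. \<omega> \<notin> Z"
    using Z by (intro AE_not_in) (auto simp: null_sets_def emeasure_eq_measure)
  then show ?thesis by eventually_elim (auto simp: Z_def)
qed

section \<open>From oriented paths to finite ancestor sets\<close>

text \<open>The deterministic link: round the times of the last \<open>k\<close> arrows to the grid.
  A jump inside an interval makes the counting process larger at its right end than at its left
  end.\<close>

lemma simple_path_in_long_path_event:
  assumes \<omega>: "\<omega> \<in> space M" and mono: "\<And>e. e \<in> edges \<Longrightarrow> mono_on {0..} (\<lambda>t. N e t \<omega>)"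
    and k: "0 < k" "k \<le> n" and T: "0 < T"
    and y: "inj_on y {..n}" and arr: "\<And>i. i < n \<Longrightarrow> arrow N \<omega> (y i) (y (Suc i)) (s i) \<and> s i \<le> T"
    and s: "\<And>i j. i \<le> j \<Longrightarrow> j < n \<Longrightarrow> s i \<le> (s j :: real)"
  shows "\<omega> \<in> long_path_event M N T k (y n)"
proof -
  define p where "p = map y [n - k..<Suc n]"
  define u where "u = (\<lambda>i. s (n - k + i))"
  \<comment> \<open>Ceiling minus one selects intervals open on the left and closed on the right: a
    jump at a grid point belongs to the interval it ends, and time \<open>T\<close> gets index
    \<open>k - 1\<close>. As \<open>u i > 0\<close>, \<open>nat\<close> truncates nothing.\<close>
  define d where "d = (\<lambda>i. nat (\<lceil>u i * k / T\<rceil> - 1))"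
  define c where "c = map d [0..<k]"
  have "(y i, y (Suc i)) \<in> edges" if "i < n" for i
    using arr[OF that] by (simp add: arrow_def)
  then have p: "p \<in> paths_to k (y n)" unfolding p_def using k by (intro walk_in_paths_to)
  have "distinct p" unfolding p_def distinct_map using y
    by (auto simp del: upt_Suc intro: inj_on_subset)
  have pn: "p ! i = y (n - k + i)" if "i \<le> k" for i
    unfolding p_def using that k by (subst nth_map) (auto simp del: upt_Suc)
  have u: "0 < u i" "u i \<le> T" if "i < k" for i
    using arr[of "n - k + i"] that k by (auto simp: u_def arrow_def jump_time_def)
  have d: "real (d i) * T / k < u i" "u i \<le> real (Suc (d i)) * T / k" "d i < k" if "i < k" for i
  proof -
    have pos: "0 < u i * k / T" using u[OF that] k T by auto
    have "u i * k / T \<le> k" using u[OF that] k T by (auto simp: field_simps)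
    then have le: "\<lceil>u i * k / T\<rceil> \<le> int k" by (simp add: ceiling_le_iff)
    have ge: "1 \<le> \<lceil>u i * k / T\<rceil>" using pos by (simp add: one_le_ceiling)
    have rd: "real (d i) = real_of_int \<lceil>u i * k / T\<rceil> - 1" using ge by (simp add: d_def)
    show "d i < k" using le ge k unfolding d_def by linarith
    have "real (d i) < u i * k / T" "u i * k / T \<le> real (d i) + 1"
      unfolding rd by linarith+
    then show "real (d i) * T / k < u i" "u i \<le> real (Suc (d i)) * T / k"
      using k T by (auto simp: field_simps)
  qed
  have "d i \<le> d j" if "i \<le> j" "j < k" for i j
  proof -
    have "u i \<le> u j" unfolding u_def using that k by (intro s) auto
    then have "u i * k / T \<le> u j * k / T"
      using T by (intro divide_right_mono mult_right_mono) auto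
    then show ?thesis unfolding d_def by (intro nat_mono diff_mono ceiling_mono) auto
  qed
  then have "sorted c" by (auto simp: c_def sorted_iff_nth_mono)
  then have c: "c \<in> sorted_words k k" using d(3) by (auto simp: sorted_words_def c_def)
  have "N (p ! i, p ! Suc i) (real (c ! i) * T / k) \<omega>
          < N (p ! i, p ! Suc i) (real (Suc (c ! i)) * T / k) \<omega>" if "i < k" for i
  proof -
    define e where "e = (p ! i, p ! Suc i)"
    have e: "e = (y (n - k + i), y (Suc (n - k + i)))"
      using that by (simp add: e_def pn)
    have ar: "arrow N \<omega> (y (n - k + i)) (y (Suc (n - k + i))) (u i)"
      using arr[of "n - k + i"] that k by (auto simp: u_def)
    have ed: "e \<in> edges" and jt: "jump_time (\<lambda>s. N e s \<omega>) (u i)"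
      using ar by (auto simp: arrow_def e)
    have ci: "c ! i = d i" using that by (simp add: c_def)
    have "0 \<le> real (d i) * T / k" using T by simp
    \<comment> \<open>A jump time strictly exceeds all earlier values, in particular the one at the
      left end; monotonicity then carries the inequality to the right end.\<close>
    then have "N e (real (d i) * T / k) \<omega> < N e (u i) \<omega>"
      using jt d(1)[OF that] by (simp add: jump_time_def)
    also have "\<dots> \<le> N e (real (Suc (d i)) * T / k) \<omega>"
      using u[OF that] d(2)[OF that] by (intro mono_onD[OF mono[OF ed]]) auto
    finally show ?thesis unfolding e_def ci .
  qed
  then show ?thesis
    unfolding long_path_event_def using p \<open>distinct p\<close> c \<omega>
    by (intro UN_I[of "(p, c)"]) auto
qed

lemma xi_bar_cong:
  assumes "\<And>x'. x' \<in> ancestors A t x \<Longrightarrow> \<xi> x' = \<xi>' x'"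
  shows "xi_bar A \<xi> t x = xi_bar A \<xi>' t x"
  using assms unfolding xi_bar_def ancestors_def by blast

theorem proposition3:
  fixes M :: "'a measure"
    and N :: "site \<times> site \<Rightarrow> real \<Rightarrow> 'a \<Rightarrow> nat"
  assumes "graphical_representation M N"
  shows "AE \<omega> in M. \<forall>x\<in>half_plane. \<forall>t\<ge>0.
           finite (ancestors (arrow N \<omega>) t x) \<and>
           (\<forall>\<xi> \<xi>'. (\<forall>x'\<in>ancestors (arrow N \<omega>) t x. \<xi> x' = \<xi>' x') \<longrightarrow>
              xi_bar (arrow N \<omega>) \<xi> t x = xi_bar (arrow N \<omega>) \<xi>' t x)"
proof -
  have "AE \<omega> in M. \<forall>e\<in>edges. mono_on {0..} (\<lambda>t. N e t \<omega>)"
  proof (rule AE_ball_countable[THEN iffD2], rule countableI_type, rule ballI)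
    fix e assume "e \<in> edges"
    then have "poisson_process M (birth_rate (fst e)) (N e)"
      using assms unfolding graphical_representation_def by (auto simp: case_prod_beta)
    then show "AE \<omega> in M. mono_on {0..} (\<lambda>t. N e t \<omega>)"
      unfolding poisson_process_def by (elim conjE) simp
  qed
  \<comment> \<open>Integer horizons leave countably many null sets to discard, yet cover all real
    times simultaneously.\<close>
  moreover have "AE \<omega> in M. \<forall>x\<in>half_plane. \<forall>j. \<exists>k>0. \<omega> \<notin> long_path_event M N (real (Suc j)) k x"
    unfolding AE_ball_countable[OF countableI_type] AE_all_countable
    by (intro ballI allI AE_not_long_path_event[OF assms]) simp_all
  moreover have "AE \<omega> in M. \<omega> \<in> space M" by (rule AE_space)
  ultimately show ?thesis
  proof eventually_elim
    case (elim \<omega>)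
    show ?case
    proof (intro ballI allI impI conjI)
      fix x and t :: real assume x: "x \<in> half_plane" and t: "0 \<le> t"
      obtain j where j: "t \<le> real (Suc j)"
        using real_arch_simple[of t] by (meson of_nat_le_iff le_SucI order_refl order_trans)
      obtain k where k: "k > 0" "\<omega> \<notin> long_path_event M N (real (Suc j)) k x"
        using elim(2) x by blast
      \<comment> \<open>Every ancestor is the head of a site path with fewer than \<open>k\<close>
        steps, and there are finitely many of these.\<close>
      have "ancestors (arrow N \<omega>) t x \<subseteq> (\<Union>n<k. hd ` paths_to n x)"
      proof
        fix x' assume "x' \<in> ancestors (arrow N \<omega>) t x"
        then have "oriented_path (arrow N \<omega>) (x', 0) (x, t)"
          by (auto simp: ancestors_def leads_to_def intro: oriented_path.start)
        from oriented_path_imp_simple[OF this] obtain n y s where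
          y: "y 0 = x'" "y n = x" "inj_on y {..n}"
            "\<And>i. i < n \<Longrightarrow> arrow N \<omega> (y i) (y (Suc i)) (s i) \<and> s i \<le> t"
            "\<And>i j. i \<le> j \<Longrightarrow> j < n \<Longrightarrow> s i \<le> (s j :: real)"
          by blast
        have "n < k"
        proof (rule ccontr)
          assume "\<not> n < k"
          then have "\<omega> \<in> long_path_event M N (real (Suc j)) k (y n)"
            using elim(1,3) k(1) y(3-5) j
            by (intro simple_path_in_long_path_event[where s = s]) (force intro: order_trans)+
          then show False using k(2) y(2) by simp
        qed
        \<comment> \<open>Here the cut keeps all \<open>n\<close> steps, so the head is
          \<open>y 0\<close>, the ancestor itself.\<close>
        moreover have "map y [n - n..<Suc n] \<in> paths_to n (y n)"
          using y(4) by (intro walk_in_paths_to) (auto simp: arrow_def)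
        moreover have "hd (map y [n - n..<Suc n]) = x'"
          using y(1) by (subst hd_map) (auto simp del: upt_Suc)
        ultimately show "x' \<in> (\<Union>n<k. hd ` paths_to n x)"
          using y(2) by (metis UN_I image_eqI lessThan_iff)
      qed
      then show "finite (ancestors (arrow N \<omega>) t x)"
        by (rule finite_subset) (use paths_to_finite_card in auto)
    next
      fix x and t :: real and \<xi> \<xi>' :: "site \<Rightarrow> bool"
      assume "\<forall>x'\<in>ancestors (arrow N \<omega>) t x. \<xi> x' = \<xi>' x'"
      then show "xi_bar (arrow N \<omega>) \<xi> t x = xi_bar (arrow N \<omega>) \<xi>' t x"
        by (intro xi_bar_cong) auto
    qed
  qed
qed

end
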